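(* Let $F\in C([0,\infty))$ be a sublinear viscosity solution of $$\begin{cases}\tfrac12\,(\partial_xF-1)(\partial_xF-2)+\dfrac{F}{x}-1=0 & \text{in }(0,\infty),\\ 0\le F(x)\le x & \text{on }[0,\infty).\end{cases}$$ Then either $F\equiv 0$, or there exists $c>0$ such that $$F(x)=\frac1c\,\bar F(cx)\qquad\text{for all }x\ge 0,$$ where $\bar F:[0,\infty)\to[0,\infty)$ is the function determined by $\bar F(0)=0$ and, for $x>0$, $$\partial_x\bar F(x)=\frac{1}{\sqrt x}\left[\left(\frac{\sqrt{x+x_0}+\sqrt x}{2}\right)^{1/3}-\left(\frac{\sqrt{x+x_0}-\sqrt x}{2}\right)^{1/3}\right],\qquad x_0=\frac{4}{27}.$$
   Context: A function $F$ on $[0,\infty)$ is called sublinear if $\lim_{x\to\infty}F(x)/x=0$. Solutions are understood in the viscosity sense for first-order Hamilton-Jacobi equations; no differentiability of $F$ is assumed. The function $\bar F$ is continuous on $[0,\infty)$. *)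

theory Defs
  imports "HOL-Analysis.Analysis"
begin

text \<open>A first-order equation \<open>H(x, u, u') = 0\<close> in an open set \<open>\<Omega>\<close> of the line, with Hamiltonian
  \<open>H x r p\<close>. Test functions are \<open>C\<^sup>1\<close> on \<open>\<Omega>\<close>; since \<open>\<Omega>\<close> is meant to be open, \<open>at x\<close> gives the local
  extrema of \<open>u - \<phi>\<close> in \<open>\<Omega>\<close>.\<close>

definition viscosity_subsolution ::
    "(real \<Rightarrow> real \<Rightarrow> real \<Rightarrow> real) \<Rightarrow> real set \<Rightarrow> (real \<Rightarrow> real) \<Rightarrow> bool" where
  "viscosity_subsolution H \<Omega> u \<longleftrightarrow>
     (\<forall>\<phi> x. \<phi> C1_differentiable_on \<Omega> \<and> x \<in> \<Omega> \<and>
        (\<forall>\<^sub>F y in at x. u y - \<phi> y \<le> u x - \<phi> x) \<longrightarrow> H x (u x) (deriv \<phi> x) \<le> 0)"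

definition viscosity_supersolution ::
    "(real \<Rightarrow> real \<Rightarrow> real \<Rightarrow> real) \<Rightarrow> real set \<Rightarrow> (real \<Rightarrow> real) \<Rightarrow> bool" where
  "viscosity_supersolution H \<Omega> u \<longleftrightarrow>
     (\<forall>\<phi> x. \<phi> C1_differentiable_on \<Omega> \<and> x \<in> \<Omega> \<and>
        (\<forall>\<^sub>F y in at x. u y - \<phi> y \<ge> u x - \<phi> x) \<longrightarrow> H x (u x) (deriv \<phi> x) \<ge> 0)"

definition viscosity_solution ::
    "(real \<Rightarrow> real \<Rightarrow> real \<Rightarrow> real) \<Rightarrow> real set \<Rightarrow> (real \<Rightarrow> real) \<Rightarrow> bool" where
  "viscosity_solution H \<Omega> u \<longleftrightarrow>
     continuous_on \<Omega> u \<and> viscosity_subsolution H \<Omega> u \<and> viscosity_supersolution H \<Omega> u"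

definition sublinear :: "(real \<Rightarrow> real) \<Rightarrow> bool" where
  "sublinear F \<longleftrightarrow> ((\<lambda>x. F x / x) \<longlongrightarrow> 0) at_top"

definition x0 :: real where
  "x0 = 4 / 27"

definition Fbar_slope :: "real \<Rightarrow> real" where
  "Fbar_slope x = 1 / sqrt x *
     (root 3 ((sqrt (x + x0) + sqrt x) / 2) - root 3 ((sqrt (x + x0) - sqrt x) / 2))"

text \<open>\<open>Fbar\<close> is a function on \<open>[0, \<infinity>)\<close>; the value \<open>0\<close> on the negative half-line only serves to make
  the description determine a total function.\<close>

definition is_Fbar :: "(real \<Rightarrow> real) \<Rightarrow> bool" where
  "is_Fbar G \<longleftrightarrow>
     continuous_on {0..} G \<and> (\<forall>x\<ge>0. 0 \<le> G x) \<and> G 0 = 0 \<and>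
     (\<forall>x>0. (G has_real_derivative Fbar_slope x) (at x)) \<and> (\<forall>x<0. G x = 0)"

definition Fbar :: "real \<Rightarrow> real" where
  "Fbar = (THE G. is_Fbar G)"

text \<open>With \<open>T\<close> the difference of cube roots one has \<open>T\<^sup>3 + T = sqrt x\<close> (Cardano), so the slope is
  \<open>1 / (1 + T\<^sup>2)\<close>, which is continuous up to \<open>0\<close>; this gives existence.\<close>

lemma Fbar_slope_eq:
  assumes "x > 0"
  shows "Fbar_slope x =
    1 / (1 + (root 3 ((sqrt (x + x0) + sqrt x) / 2) - root 3 ((sqrt (x + x0) - sqrt x) / 2))\<^sup>2)"
proof -
  define s where "s = sqrt x"
  define a where "a = root 3 ((sqrt (x + x0) + s) / 2)"
  define b where "b = root 3 ((sqrt (x + x0) - s) / 2)"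
  have s: "s > 0" using assms by (simp add: s_def)
  have a3: "a ^ 3 = (sqrt (x + x0) + s) / 2" unfolding a_def by (rule odd_real_root_pow) simp
  have b3: "b ^ 3 = (sqrt (x + x0) - s) / 2" unfolding b_def by (rule odd_real_root_pow) simp
  have "(sqrt (x + x0))\<^sup>2 = x + x0" "s\<^sup>2 = x" using assms by (simp_all add: x0_def s_def)
  then have "(sqrt (x + x0) + s) / 2 * ((sqrt (x + x0) - s) / 2) = x0 / 4"
    by (simp add: algebra_simps power2_eq_square)
  also have "\<dots> = (1 / 3) ^ 3" by (simp add: x0_def power3_eq_cube)
  finally have "a * b = root 3 ((1 / 3) ^ 3)"
    unfolding a_def b_def by (metis real_root_mult)
  then have ab: "a * b = 1 / 3" by (simp add: odd_real_root_power_cancel)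
  have "(a - b) ^ 3 = a ^ 3 - b ^ 3 - 3 * (a * b) * (a - b)"
    by (simp add: algebra_simps power3_eq_cube)
  then have "(a - b) ^ 3 + (a - b) = s" by (simp add: ab a3 b3 field_simps)
  then have c: "(a - b) * (1 + (a - b)\<^sup>2) = s"
    by (simp add: power3_eq_cube power2_eq_square algebra_simps)
  have "1 + (a - b)\<^sup>2 \<noteq> 0" by (smt (verit) zero_le_power2)
  then have "1 / s * (a - b) = 1 / (1 + (a - b)\<^sup>2)"
    using s c by (simp add: field_simps)
  then show ?thesis by (simp add: Fbar_slope_def a_def b_def s_def)
qed

lemma ex1_is_Fbar: "\<exists>!G. is_Fbar G"
proof -
  define g where "g x = 1 / (1 + (root 3 ((sqrt (x + x0) + sqrt x) / 2)
      - root 3 ((sqrt (x + x0) - sqrt x) / 2))\<^sup>2)" for x :: real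
  have cont: "continuous_on S g" for S
    unfolding g_def by (intro continuous_intros ballI) (auto, smt (verit) zero_le_power2)
  have pos: "g x \<ge> 0" for x by (simp add: g_def)
  define G where "G x = (if x < 0 then 0 else integral {0..x} g)" for x
  have I: "((\<lambda>x. integral {0..x} g) has_real_derivative g t) (at t within {0..b})"
    if "t \<in> {0..b}" for t b
    using integral_has_real_derivative cont that by blast
  have ci: "continuous_on {0..b} (\<lambda>x. integral {0..x} g)" for b
    by (rule DERIV_continuous_on[OF I])
  have ci': "continuous_on {0..} (\<lambda>x. integral {0..x} g)"
    unfolding continuous_on_eq_continuous_within
  proof
    fix x :: real assume "x \<in> {0..}"
    then have "continuous (at x within {0..x + 1}) (\<lambda>x. integral {0..x} g)"
      using ci[of "x + 1"] by (simp add: continuous_on_eq_continuous_within)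
    moreover have "at x within {0..x + 1} = at x within {0..}"
      by (rule at_within_nhd[where S = "{..<x + 1}"]) auto
    ultimately show "continuous (at x within {0..}) (\<lambda>x. integral {0..x} g)"
      by (simp add: continuous_within)
  qed
  have "continuous_on {0..} G"
    using ci' by (rule continuous_on_eq) (simp add: G_def)
  moreover have "(G has_real_derivative Fbar_slope x) (at x)" if "x > 0" for x
  proof -
    have "((\<lambda>x. integral {0..x} g) has_real_derivative g x) (at x within {0..x + 1})"
      using that by (intro I) auto
    then have "((\<lambda>x. integral {0..x} g) has_real_derivative g x) (at x)"
      using that by (simp add: at_within_Icc_at)
    then have "(G has_real_derivative g x) (at x)"
      by (rule has_field_derivative_transform_within_open[where S = "{0<..}"])
         (use that in \<open>auto simp: G_def\<close>)
    then show ?thesis using Fbar_slope_eq[OF that] by (simp add: g_def)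
  qed
  moreover have "0 \<le> G x" for x
    by (simp add: G_def) (meson Henstock_Kurzweil_Integration.integral_nonneg cont
        integrable_continuous_interval pos)
  ultimately have "is_Fbar G"
    unfolding is_Fbar_def by (simp add: G_def[of 0]) (simp add: G_def)
  moreover have "G1 = G2" if "is_Fbar G1" "is_Fbar G2" for G1 G2
  proof
    fix x :: real
    consider "x < 0" | "x = 0" | "x > 0" by linarith
    then show "G1 x = G2 x"
    proof cases
      case 3
      have "continuous_on {0..x} (\<lambda>y. G1 y - G2 y)"
        using that
        by (intro continuous_intros; unfold is_Fbar_def; meson atLeastatMost_subset_iff
            continuous_on_subset Icc_subset_Ici_iff order_refl)
      moreover have "((\<lambda>y. G1 y - G2 y) has_real_derivative 0) (at y)" if "0 < y" for y
        using DERIV_diff \<open>is_Fbar G1\<close> \<open>is_Fbar G2\<close> that unfolding is_Fbar_def by fastforce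
      ultimately have "G1 x - G2 x = G1 0 - G2 0"
        using DERIV_isconst_end[OF 3] by blast
      then show ?thesis using that by (simp add: is_Fbar_def)
    qed (use that in \<open>auto simp: is_Fbar_def\<close>)
  qed
  ultimately show ?thesis by blast
qed

lemma is_Fbar_Fbar: "is_Fbar Fbar"
  unfolding Fbar_def by (rule theI'[OF ex1_is_Fbar])

end

theory Submission
  imports Defs
begin

text \<open>
  Multiplied out, the equation says \<open>F / x = p * (3 - p) / 2\<close> for the slope \<open>p = \<partial>\<^sub>x F\<close>. For
  \<open>F / x \<in> [0, 1]\<close> it has a slow root in \<open>[0, 1]\<close>, called \<open>slow_slope (F / x)\<close> below, and a fast root
  in \<open>[2, 3]\<close>, and the heart of the proof is that a solution with \<open>0 \<le> F \<le> x\<close> never uses the fast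
  one.

  The reason is that slopes strictly between the two roots are forbidden for test functions touching
  \<open>F\<close> from below. In particular \<open>F - 3/2 x\<close> has no local minimum; as it vanishes at \<open>0\<close> and is
  negative afterwards, it must decrease all the way (\<open>bounded_supersolution_slow\<close>). Hence every
  test function touching from below has slope at most \<open>3/2\<close>, and the supersolution property puts this
  slope below the slow root, whereas the subsolution property puts the slope of every test function
  touching from above over the slow root. The slow root \<open>g x\<close> is a continuous function of \<open>x\<close>; if
  \<open>G\<close> is a primitive of \<open>g\<close>, then \<open>F - G\<close> is both increasing and decreasing in the viscosity sense,
  so it is constant and \<open>F\<close> is a classical solution of \<open>F' = slow_slope (F / x)\<close>
  (\<open>viscosity_solution_classical\<close>).

  This ordinary differential equation has the first integral \<open>(1 - F') / (F'\<^sup>3 x)\<close> wherever \<open>F > 0\<close>,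
  and positivity at one point spreads to all of \<open>(0, \<infinity>)\<close> because \<open>F\<close> increases and \<open>F / x\<close>
  decreases. If the constant \<open>c\<close> is zero, then \<open>F x = x\<close>, which sublinearity excludes. Otherwise
  \<open>p = F' x\<close> is the unique positive root of \<open>p + c x p\<^sup>3 = 1\<close>, an equation which \<open>Fbar_slope (c x)\<close>
  solves as well by Cardano's formula, and \<open>F\<close> agrees with \<open>Fbar (c x) / c\<close> after integration
  from \<open>0\<close>.
\<close>

section \<open>Monotonicity from touching test functions\<close>

text \<open>If \<open>w b < w a\<close>, a decreasing function that falls steeply near \<open>a\<close> and is almost flat
  afterwards can be slid down onto \<open>w\<close> so that it touches in the interior of \<open>[a, b]\<close>. An
  exponential does this and has a strictly negative slope everywhere.\<close>

lemma exponential_touches_from_above: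
  fixes w :: "real \<Rightarrow> real"
  assumes "a < b" and cont: "continuous_on {a..b} w" and "w b < w a"
  obtains x \<delta> k where "a < x" "x < b" "0 < \<delta>" "0 < k"
    "\<forall>y\<in>{a..b}. w y - \<delta> * exp (- k * y) \<le> w x - \<delta> * exp (- k * x)"
proof -
  define \<eta> where "\<eta> = (w a - w b) / 2"
  have \<eta>: "0 < \<eta>" using assms by (simp add: \<eta>_def)
  obtain d where d: "d > 0" "\<And>y. y \<in> {a..b} \<Longrightarrow> dist y a < d \<Longrightarrow> dist (w y) (w a) < \<eta> / 2"
    using cont assms(1) \<eta> unfolding continuous_on_iff
    by (metis atLeastAtMost_iff half_gt_zero less_eq_real_def)
  \<comment> \<open>At \<open>m\<close> the function \<open>w\<close> has hardly left \<open>w a\<close>. The exponential is normalised to be \<open>\<eta>\<close> there, and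
    \<open>k\<close> makes it drop by at least \<open>w a - w b\<close> between \<open>a\<close> and \<open>m\<close>, which rules out a maximum at \<open>a\<close>.\<close>
  define m where "m = a + min d (b - a) / 2"
  have m: "a < m" "m < b" using d assms(1) by (auto simp: m_def min_def field_simps)
  have "dist m a < d" using d assms(1) by (auto simp: m_def dist_real_def min_def)
  then have "dist (w m) (w a) < \<eta> / 2" using d(2) m by simp
  then have wm: "w m > w b + \<eta>"
    using \<eta> unfolding dist_real_def \<eta>_def by (simp add: abs_if field_simps split: if_splits)
  define k where "k = (w a - w b) / (\<eta> * (m - a))"
  have k: "k > 0" using assms \<eta> m by (simp add: k_def)
  define \<delta> where "\<delta> = \<eta> * exp (k * m)"
  have \<delta>: "\<delta> > 0" using \<eta> by (simp add: \<delta>_def)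
  define v where "v y = w y - \<delta> * exp (- k * y)" for y
  have v: "v y = w y - \<eta> * exp (k * (m - y))" for y
    by (simp add: v_def \<delta>_def mult_exp_exp algebra_simps)
  have "continuous_on {a..b} v" unfolding v_def by (intro continuous_intros cont)
  then obtain x where x: "x \<in> {a..b}" "\<forall>y\<in>{a..b}. v y \<le> v x"
    using continuous_attains_sup[of "{a..b}" v] assms(1) by auto
  have vm: "v m > w b" using wm by (simp add: v)
  have "\<eta> * (1 + k * (m - a)) \<le> \<eta> * exp (k * (m - a))"
    using \<eta> exp_ge_add_one_self by simp
  moreover have "\<eta> * (k * (m - a)) = w a - w b" using \<eta> m by (simp add: k_def)
  ultimately have "v a \<le> w b" using \<eta> by (simp add: v algebra_simps)
  moreover have "v b \<le> w b" using \<eta> by (simp add: v)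
  moreover have "v m \<le> v x" using x m by auto
  ultimately have "x \<noteq> a" "x \<noteq> b" using vm by auto
  then show ?thesis using that[of x \<delta> k] x \<delta> k by (auto simp: v_def)
qed

text \<open>A continuous function is increasing as soon as \<open>w' \<ge> 0\<close> holds in the viscosity sense: a decrease
  would let an exponential of negative slope touch \<open>w\<close> from above.\<close>

lemma mono_on_if_touching_slopes_nonneg:
  fixes w :: "real \<Rightarrow> real"
  assumes "is_interval S" and cont: "continuous_on S w"
    and touch: "\<And>\<psi> D x. \<lbrakk>x \<in> S; \<And>y. (\<psi> has_real_derivative D y) (at y); continuous_on UNIV D;
      \<forall>\<^sub>F y in at x. w y - \<psi> y \<le> w x - \<psi> x\<rbrakk> \<Longrightarrow> 0 \<le> D x"
  shows "mono_on S w"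
proof (rule mono_onI, rule ccontr)
  fix a b assume ab: "a \<in> S" "b \<in> S" "a \<le> b" "\<not> w a \<le> w b"
  then have "a < b" by (cases "a = b") auto
  have sub: "{a..b} \<subseteq> S" by (auto intro: mem_is_interval_1_I[OF assms(1) ab(1,2)])
  have "w b < w a" using ab by simp
  then obtain x \<delta> k where x: "a < x" "x < b" "0 < \<delta>" "0 < k"
    "\<forall>y\<in>{a..b}. w y - \<delta> * exp (- k * y) \<le> w x - \<delta> * exp (- k * x)"
    by (rule exponential_touches_from_above[OF \<open>a < b\<close> continuous_on_subset[OF cont sub]])
  have "\<forall>\<^sub>F y in at x. y \<in> {a<..<b}" using x by (intro eventually_at_in_open') auto
  then have "\<forall>\<^sub>F y in at x. w y - \<delta> * exp (- k * y) \<le> w x - \<delta> * exp (- k * x)"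
    by eventually_elim (use x in auto)
  moreover have "((\<lambda>y. \<delta> * exp (- k * y)) has_real_derivative - \<delta> * k * exp (- k * y)) (at y)" for y
    by (auto intro!: derivative_eq_intros)
  moreover have "continuous_on UNIV (\<lambda>y. - \<delta> * k * exp (- k * y))" by (intro continuous_intros)
  moreover have "x \<in> S" using sub x by auto
  ultimately have "0 \<le> - \<delta> * k * exp (- k * x)"
    by (intro touch[of x "\<lambda>y. \<delta> * exp (- k * y)" "\<lambda>y. - \<delta> * k * exp (- k * y)"])
  then show False using x by (simp add: mult_le_0_iff)
qed

section \<open>The slow root of the equation\<close>

definition slow_slope :: "real \<Rightarrow> real" where
  "slow_slope u = (3 - sqrt (9 - 8 * u)) / 2"

lemma slow_slope_root:
  assumes "u \<le> 1"
  shows "u = slow_slope u * (3 - slow_slope u) / 2"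
proof -
  have "(sqrt (9 - 8 * u))\<^sup>2 = 9 - 8 * u" using assms by simp
  then show ?thesis by (simp add: slow_slope_def power2_eq_square field_simps)
qed

lemma slow_slope_le_1: "u \<le> 1 \<Longrightarrow> slow_slope u \<le> 1"
  by (simp add: slow_slope_def)

lemma slow_slope_nonneg:
  assumes "0 \<le> u"
  shows "0 \<le> slow_slope u"
proof -
  have "sqrt (9 - 8 * u) \<le> sqrt (3\<^sup>2)" using assms by (intro real_sqrt_le_mono) simp
  then show ?thesis by (simp add: slow_slope_def)
qed

lemma slow_slope_le_self:
  assumes "0 \<le> u" "u \<le> 1"
  shows "slow_slope u \<le> u"
proof -
  have "slow_slope u * (slow_slope u - 1) \<le> 0"
    using assms slow_slope_le_1 slow_slope_nonneg by (simp add: mult_nonneg_nonpos)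
  then show ?thesis using slow_slope_root[of u] assms by (simp add: field_simps)
qed

lemma slow_slope_has_derivative:
  assumes "u \<le> 1"
  shows "(slow_slope has_real_derivative 2 / (3 - 2 * slow_slope u)) (at u)"
  unfolding slow_slope_def[abs_def] using assms
  by (auto intro!: derivative_eq_intros simp: field_simps)

lemma hamiltonian_nonpos_imp_ge_slow_slope:
  assumes "u \<le> 1" and "1 / 2 * (p - 1) * (p - 2) + u - 1 \<le> 0"
  shows "slow_slope u \<le> p"
proof (rule ccontr)
  assume "\<not> ?thesis"
  then have "(p - slow_slope u) * (p + slow_slope u - 3) > 0"
    using slow_slope_le_1[OF assms(1)] by (intro mult_neg_neg) auto
  then show False using assms(2) slow_slope_root[OF assms(1)] by (simp add: field_simps)
qed

lemma hamiltonian_nonneg_imp_le_slow_slope: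
  assumes "u \<le> 1" "p \<le> 3 / 2" and "1 / 2 * (p - 1) * (p - 2) + u - 1 \<ge> 0"
  shows "p \<le> slow_slope u"
proof (rule ccontr)
  assume "\<not> ?thesis"
  then have "(p - slow_slope u) * (p + slow_slope u - 3) < 0"
    using slow_slope_le_1[OF assms(1)] assms(2) by (intro mult_pos_neg) auto
  then show False using assms(3) slow_slope_root[OF assms(1)] by (simp add: field_simps)
qed

section \<open>Viscosity solutions below the diagonal are classical\<close>

lemma C1_differentiable_on_if_has_real_derivative:
  fixes \<phi> :: "real \<Rightarrow> real"
  assumes "\<And>y. y \<in> \<Omega> \<Longrightarrow> (\<phi> has_real_derivative D y) (at y)" and "continuous_on \<Omega> D"
  shows "\<phi> C1_differentiable_on \<Omega>"
  unfolding C1_differentiable_on_def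
  using assms by (auto simp: has_real_derivative_iff_has_vector_derivative)

lemma viscosity_subsolutionD:
  assumes "viscosity_subsolution H \<Omega> u" "x \<in> \<Omega>" "\<forall>\<^sub>F y in at x. u y - \<phi> y \<le> u x - \<phi> x"
    and \<phi>: "\<And>y. y \<in> \<Omega> \<Longrightarrow> (\<phi> has_real_derivative D y) (at y)" "continuous_on \<Omega> D"
  shows "H x (u x) (D x) \<le> 0"
proof -
  have "deriv \<phi> x = D x" using \<phi>(1)[OF assms(2)] by (rule DERIV_imp_deriv)
  moreover have "\<phi> C1_differentiable_on \<Omega>" using \<phi> by (rule C1_differentiable_on_if_has_real_derivative)
  ultimately show ?thesis
    using assms(1)[unfolded viscosity_subsolution_def, THEN spec, of \<phi>, THEN spec, of x] assms(2,3)
    by simp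
qed

lemma viscosity_supersolutionD:
  assumes "viscosity_supersolution H \<Omega> u" "x \<in> \<Omega>" "\<forall>\<^sub>F y in at x. u y - \<phi> y \<ge> u x - \<phi> x"
    and \<phi>: "\<And>y. y \<in> \<Omega> \<Longrightarrow> (\<phi> has_real_derivative D y) (at y)" "continuous_on \<Omega> D"
  shows "H x (u x) (D x) \<ge> 0"
proof -
  have "deriv \<phi> x = D x" using \<phi>(1)[OF assms(2)] by (rule DERIV_imp_deriv)
  moreover have "\<phi> C1_differentiable_on \<Omega>" using \<phi> by (rule C1_differentiable_on_if_has_real_derivative)
  ultimately show ?thesis
    using assms(1)[unfolded viscosity_supersolution_def, THEN spec, of \<phi>, THEN spec, of x] assms(2,3)
    by simp
qed

text \<open>A line of slope \<open>3/2\<close> cannot touch \<open>F\<close> from below: the Hamiltonian would be \<open>F / x - 9/8\<close>, and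
  \<open>F / x \<le> 1\<close>. If \<open>F - 3/2 x\<close> rose from \<open>a\<close> to \<open>b\<close>, it would be lower at \<open>a\<close> than at both \<open>0\<close> and
  \<open>b\<close>, so its minimum over \<open>[0, b]\<close> would be such a touching point. The growth bound \<open>F x \<le> x\<close> is
  what puts the value at \<open>0\<close> above the value at \<open>b\<close>.\<close>

lemma bounded_supersolution_slow:
  assumes cont: "continuous_on {0..} F"
    and super: "viscosity_supersolution (\<lambda>x r p. 1 / 2 * (p - 1) * (p - 2) + r / x - 1) {0<..} F"
    and bd: "\<forall>x\<ge>0. 0 \<le> F x \<and> F x \<le> x"
    and ab: "0 < a" "a \<le> b"
  shows "F b - F a \<le> 3 / 2 * (b - a)"
proof (rule ccontr)
  assume "\<not> ?thesis"
  then have less: "F a - 3 / 2 * a < F b - 3 / 2 * b" by (simp add: algebra_simps)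
  then have "a < b" using ab by (cases "a = b") auto
  define w where "w y = F y - 3 / 2 * y" for y
  have "continuous_on {0..b} w" unfolding w_def
    by (intro continuous_intros continuous_on_subset[OF cont]) auto
  then obtain x where x: "x \<in> {0..b}" "\<forall>y\<in>{0..b}. w x \<le> w y"
    using continuous_attains_inf[of "{0..b}" w] ab by auto
  have "w x \<le> w a" using x ab by auto
  moreover have "w a < w b" using less by (simp add: w_def)
  moreover have "w b < w 0" using bd[rule_format, of b] bd[rule_format, of 0] ab by (simp add: w_def)
  ultimately have "x \<noteq> 0" "x \<noteq> b" by auto
  then have x0: "0 < x" "x < b" using x(1) by auto
  have "\<forall>\<^sub>F y in at x. y \<in> {0<..<b}" using x0 by (intro eventually_at_in_open') auto
  then have "\<forall>\<^sub>F y in at x. F y - 3 / 2 * y \<ge> F x - 3 / 2 * x"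
    by eventually_elim (use x(2) in \<open>auto simp: w_def\<close>)
  moreover have "x \<in> {0<..}" using x0 by simp
  ultimately have "1 / 2 * (3 / 2 - 1) * (3 / 2 - 2) + F x / x - 1 \<ge> 0"
    by (intro viscosity_supersolutionD[OF super, of x "\<lambda>y. 3 / 2 * y" "\<lambda>_. 3 / 2"])
       (auto intro!: derivative_eq_intros)
  then have "9 / 8 \<le> F x / x" by simp
  moreover have "F x / x \<le> 1" using bd x0 by simp
  ultimately show False by linarith
qed

text \<open>Both roots of the equation are available to a solution a priori. The bound \<open>3/2\<close> on slopes from
  below, which lies halfway between them, leaves the slow root only. That root depends on \<open>F\<close> but not
  on the test function, so \<open>F\<close> can be compared with the primitive \<open>G\<close> of a given continuous
  function: adding \<open>G\<close> to a test function turns the two one-sided slope bounds into the viscosity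
  form of \<open>(F - G)' \<ge> 0\<close> and \<open>(F - G)' \<le> 0\<close>.\<close>

lemma viscosity_solution_classical:
  assumes cont: "continuous_on {0..} F"
    and visc: "viscosity_solution (\<lambda>x r p. 1 / 2 * (p - 1) * (p - 2) + r / x - 1) {0<..} F"
    and bd: "\<forall>x\<ge>0. 0 \<le> F x \<and> F x \<le> x"
    and "0 < x"
  shows "(F has_real_derivative slow_slope (F x / x)) (at x)"
proof -
  define g where "g x = slow_slope (F x / x)" for x
  have contF: "continuous_on {0<..} F" by (rule continuous_on_subset[OF cont]) auto
  have contg: "continuous_on {0<..} g" unfolding g_def slow_slope_def
    by (intro continuous_intros contF) auto
  have u1: "F y / y \<le> 1" if "0 < y" for y using bd that by simp
  have "isCont g y" if "0 < y" for y
    using contg that by (simp add: continuous_on_eq_continuous_at)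
  then obtain G where "\<forall>y. ereal 0 < ereal y \<longrightarrow> ereal y < \<infinity> \<longrightarrow> (G has_vector_derivative g y) (at y)"
    using einterval_antiderivative[of "ereal 0" \<infinity> g] by auto
  then have G: "(G has_real_derivative g y) (at y)" if "0 < y" for y
    using that by (simp add: has_real_derivative_iff_has_vector_derivative)
  have contG: "continuous_on {0<..} G"
    by (rule DERIV_continuous_on[where D = g]) (auto intro: G has_field_derivative_at_within)
  have sub: "viscosity_subsolution (\<lambda>x r p. 1 / 2 * (p - 1) * (p - 2) + r / x - 1) {0<..} F"
    and super: "viscosity_supersolution (\<lambda>x r p. 1 / 2 * (p - 1) * (p - 2) + r / x - 1) {0<..} F"
    using visc by (simp_all add: viscosity_solution_def)
  have "mono_on {0<..} (\<lambda>y. F y - G y)"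
  proof (rule mono_on_if_touching_slopes_nonneg)
    fix \<psi> D y
    assume y: "y \<in> {0<..}" and \<psi>: "\<And>y. (\<psi> has_real_derivative D y) (at y)"
      and D: "continuous_on UNIV D"
      and touch: "\<forall>\<^sub>F z in at y. F z - G z - \<psi> z \<le> F y - G y - \<psi> y"
    have contD: "continuous_on {0<..} (\<lambda>z. g z + D z)"
      by (intro continuous_intros contg continuous_on_subset[OF D]) simp
    have d: "((\<lambda>z. G z + \<psi> z) has_real_derivative g z + D z) (at z)" if "z \<in> {0<..}" for z
      using G \<psi> that by (intro DERIV_add) auto
    have above: "\<forall>\<^sub>F z in at y. F z - (G z + \<psi> z) \<le> F y - (G y + \<psi> y)"
      using touch by (simp add: algebra_simps)
    have "1 / 2 * (g y + D y - 1) * (g y + D y - 2) + F y / y - 1 \<le> 0"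
      by (rule viscosity_subsolutionD[OF sub y above d contD])
    then have "g y \<le> g y + D y"
      unfolding g_def[of y] using y u1 by (intro hamiltonian_nonpos_imp_ge_slow_slope) auto
    then show "0 \<le> D y" by simp
  qed (auto intro!: continuous_intros contF contG)
  moreover have "mono_on {0<..} (\<lambda>y. G y - F y)"
  proof (rule mono_on_if_touching_slopes_nonneg)
    fix \<psi> D y
    assume "y \<in> {0<..}" and \<psi>: "\<And>y. (\<psi> has_real_derivative D y) (at y)"
      and D: "continuous_on UNIV D"
      and touch: "\<forall>\<^sub>F z in at y. G z - F z - \<psi> z \<le> G y - F y - \<psi> y"
    then have y: "0 < y" by simp
    define \<phi> where "\<phi> z = G z - \<psi> z" for z
    have contD: "continuous_on {0<..} (\<lambda>z. g z - D z)"
      by (intro continuous_intros contg continuous_on_subset[OF D]) simp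
    have d: "(\<phi> has_real_derivative g z - D z) (at z)" if "z \<in> {0<..}" for z
      unfolding \<phi>_def using G \<psi> that by (intro DERIV_diff) auto
    have below: "\<forall>\<^sub>F z in at y. F z - \<phi> z \<ge> F y - \<phi> y"
      using touch unfolding \<phi>_def by eventually_elim simp
    have "1 / 2 * (g y - D y - 1) * (g y - D y - 2) + F y / y - 1 \<ge> 0"
      by (rule viscosity_supersolutionD[OF super _ below d contD]) (use y in auto)
    moreover have "g y - D y \<le> 3 / 2"
    proof (rule tendsto_upperbound)
      show "((\<lambda>z. (\<phi> z - \<phi> y) / (z - y)) \<longlongrightarrow> g y - D y) (at_right y)"
        using d[of y] y by (simp add: has_field_derivative_iff filterlim_at_split)
      have "\<forall>\<^sub>F z in at_right y. F z - \<phi> z \<ge> F y - \<phi> y"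
        using below by (simp add: eventually_at_split)
      moreover have "\<forall>\<^sub>F z in at_right y. y < z" by (simp add: eventually_at_right_less)
      ultimately show "\<forall>\<^sub>F z in at_right y. (\<phi> z - \<phi> y) / (z - y) \<le> 3 / 2"
      proof eventually_elim
        case (elim z)
        then have "F z - F y \<le> 3 / 2 * (z - y)"
          by (intro bounded_supersolution_slow[OF cont super bd y]) simp
        then show ?case using elim by (simp add: divide_le_eq)
      qed
    qed simp
    ultimately have "g y - D y \<le> g y"
      unfolding g_def[of y] using y u1 by (intro hamiltonian_nonneg_imp_le_slow_slope) auto
    then show "0 \<le> D y" by simp
  qed (auto intro!: continuous_intros contF contG)
  ultimately have le: "F y - G y \<le> F z - G z" "G y - F y \<le> G z - F z" if "0 < y" "y \<le> z" for y z
    using that by (auto dest!: mono_onD[of _ _ y z])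
  have eq: "F y - G y = F z - G z" if "0 < y" "0 < z" for y z
    using le[of y z] le[of z y] that by linarith
  have "((\<lambda>y. G y + (F x - G x)) has_real_derivative g x) (at x)"
    using G[OF \<open>0 < x\<close>] by (auto intro!: derivative_eq_intros)
  then have "(F has_real_derivative g x) (at x)"
    by (rule has_field_derivative_transform_within_open[where S = "{0<..}"])
       (use eq[OF _ \<open>0 < x\<close>] \<open>0 < x\<close> in \<open>auto simp: algebra_simps\<close>)
  then show ?thesis by (simp add: g_def)
qed

section \<open>Integrating the differential equation\<close>

text \<open>To the right of \<open>a\<close>, positivity persists because \<open>F' \<ge> 0\<close>. To the left, it persists because
  \<open>F / x\<close> has a derivative of the sign of \<open>F' - F / x\<close>, and the slow root \<open>F' = slow_slope (F / x)\<close> is at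
  most \<open>F / x\<close>.\<close>

lemma slow_solution_pos:
  assumes ode: "\<And>x. 0 < x \<Longrightarrow> (F has_real_derivative slow_slope (F x / x)) (at x)"
    and bd: "\<forall>x\<ge>0. 0 \<le> F x \<and> F x \<le> x"
    and "0 < a" "0 < F a" "0 < x"
  shows "0 < F x"
proof (cases "a \<le> x")
  case True
  have "F a \<le> F x"
    using ode bd \<open>0 < a\<close>
    by (intro DERIV_nonneg_imp_nondecreasing[OF True])
       (meson divide_nonneg_pos less_le_trans less_imp_le slow_slope_nonneg)
  then show ?thesis using assms by simp
next
  case False
  have "F a / a \<le> F x / x"
  proof (rule DERIV_nonpos_imp_nonincreasing[of x a "\<lambda>y. F y / y"])
    fix y assume "x \<le> y" "y \<le> a"
    then have y: "0 < y" using assms by simp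
    have "slow_slope (F y / y) \<le> F y / y" using bd y by (intro slow_slope_le_self) auto
    then have "slow_slope (F y / y) * y - F y \<le> 0" using y by (simp add: field_simps)
    moreover have "((\<lambda>y. F y / y) has_real_derivative (slow_slope (F y / y) * y - F y) / (y * y)) (at y)"
      using ode[OF y] y by (auto intro!: derivative_eq_intros)
    ultimately show "\<exists>D. ((\<lambda>y. F y / y) has_real_derivative D) (at y) \<and> D \<le> 0"
      using y by (intro exI conjI) (auto simp: divide_nonpos_pos)
  qed (use False in simp)
  moreover have "0 < F a / a" using assms by simp
  ultimately have "0 < F x / x" by linarith
  then show ?thesis using assms by (simp add: zero_less_divide_iff)
qed

text \<open>With \<open>p = F'\<close>, differentiating \<open>F = x * p * (3 - p) / 2\<close> gives
  \<open>p' = p * (p - 1) / (x * (3 - 2 * p))\<close>, an equation that separates: its solutions satisfy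
  \<open>1 - p = c * x * p\<^sup>3\<close>.\<close>

lemma slow_solution_first_integral:
  assumes ode: "\<And>x. 0 < x \<Longrightarrow> (F has_real_derivative slow_slope (F x / x)) (at x)"
    and bd: "\<forall>x\<ge>0. 0 \<le> F x \<and> F x \<le> x"
    and pos: "\<And>x. 0 < x \<Longrightarrow> 0 < F x"
  obtains c where "c \<ge> 0"
    "\<And>x. 0 < x \<Longrightarrow> slow_slope (F x / x) + c * x * slow_slope (F x / x) ^ 3 = 1"
proof -
  define p where "p x = slow_slope (F x / x)" for x
  have u: "0 < F x / x" "F x / x \<le> 1" if "0 < x" for x using bd pos that by auto
  have root: "F x / x = p x * (3 - p x) / 2" if "0 < x" for x
    unfolding p_def using u(2)[OF that] by (rule slow_slope_root)
  have p: "0 < p x" "p x \<le> 1" if "0 < x" for x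
  proof -
    show "p x \<le> 1" unfolding p_def using u[OF that] by (simp add: slow_slope_le_1)
    have "p x \<noteq> 0" using root[OF that] u[OF that] by auto
    moreover have "0 \<le> p x" unfolding p_def using u(1)[OF that] by (simp add: slow_slope_nonneg)
    ultimately show "0 < p x" by simp
  qed
  have dp: "(p has_real_derivative p x * (p x - 1) / (x * (3 - 2 * p x))) (at x)" if x: "0 < x" for x
  proof -
    have du: "((\<lambda>x. F x / x) has_real_derivative (p x - F x / x) / x) (at x)"
      using ode[OF x] x by (auto intro!: derivative_eq_intros simp: p_def field_simps)
    have "(p has_real_derivative 2 / (3 - 2 * p x) * ((p x - F x / x) / x)) (at x)"
      unfolding p_def[abs_def]
      by (rule DERIV_chain2[OF slow_slope_has_derivative[OF u(2)[OF x]] du[unfolded p_def]])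
    moreover have "2 / (3 - 2 * p x) * ((p x - F x / x) / x) = p x * (p x - 1) / (x * (3 - 2 * p x))"
      unfolding root[OF x] using x p[OF x] by (simp add: field_simps)
    ultimately show ?thesis by simp
  qed
  define k where "k x = (1 - p x) / (p x ^ 3 * x)" for x
  have dk: "(k has_real_derivative 0) (at x)" if x: "0 < x" for x
  proof -
    define q where "q = p x * (p x - 1) / (x * (3 - 2 * p x))"
    have nz: "p x \<noteq> 0" "x \<noteq> 0" "3 - 2 * p x \<noteq> 0" using p[OF x] x by auto
    have q: "q * (x * (3 - 2 * p x)) = p x * (p x - 1)" using nz by (simp add: q_def)
    have "(k has_real_derivative ((0 - q) * (p x ^ 3 * x)
        - (1 - p x) * (3 * p x ^ 2 * q * x + p x ^ 3)) / (p x ^ 3 * x * (p x ^ 3 * x))) (at x)"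
      unfolding k_def using dp[OF x, folded q_def] nz
      by (auto intro!: derivative_eq_intros simp: algebra_simps)
    moreover have "(0 - q) * (p x ^ 3 * x) - (1 - p x) * (3 * p x ^ 2 * q * x + p x ^ 3)
        = p x ^ 2 * (- (q * (x * (3 - 2 * p x))) - (1 - p x) * p x)"
      by (simp add: algebra_simps power3_eq_cube power2_eq_square)
    moreover have "\<dots> = 0" unfolding q by (simp add: algebra_simps)
    ultimately show ?thesis by simp
  qed
  have "\<exists>d. \<forall>x\<in>{0<..}. k x = d"
    by (rule has_field_derivative_zero_constant) (auto intro: has_field_derivative_at_within dk)
  then have k: "k x = k 1" if "0 < x" for x using that by (metis greaterThan_iff zero_less_one)
  show ?thesis
  proof
    show "0 \<le> k 1" unfolding k_def using p[of 1] by simp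
    show "slow_slope (F x / x) + k 1 * x * slow_slope (F x / x) ^ 3 = 1" if x: "0 < x" for x
      using k[OF x] p[OF x] x unfolding k_def p_def[symmetric] by (simp add: field_simps)
  qed
qed

section \<open>Identification with the explicit profile\<close>

text \<open>If \<open>T\<close> denotes the difference of cube roots in the definition of the slope, that definition
  reads \<open>T = p * sqrt y\<close> for \<open>p = Fbar_slope y\<close>, and Cardano's formula reads \<open>p = 1 / (1 + T\<^sup>2)\<close>;
  eliminating \<open>T\<close> leaves the cubic equation of the first integral.\<close>

lemma Fbar_slope_root:
  assumes "0 < y"
  shows "0 < Fbar_slope y" and "Fbar_slope y + y * Fbar_slope y ^ 3 = 1"
proof -
  define T where "T = root 3 ((sqrt (y + x0) + sqrt y) / 2) - root 3 ((sqrt (y + x0) - sqrt y) / 2)"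
  have s: "Fbar_slope y = 1 / (1 + T\<^sup>2)" unfolding T_def by (rule Fbar_slope_eq[OF assms])
  have T1: "1 + T\<^sup>2 > 0" by (simp add: add_pos_nonneg)
  show "0 < Fbar_slope y" using T1 by (simp add: s)
  have "T = Fbar_slope y * sqrt y" using assms by (simp add: Fbar_slope_def T_def)
  then have "T\<^sup>2 = y * Fbar_slope y ^ 2" using assms by (simp add: power_mult_distrib)
  then have "Fbar_slope y * (1 + y * Fbar_slope y ^ 2) = 1" using s T1 by simp
  then show "Fbar_slope y + y * Fbar_slope y ^ 3 = 1"
    by (simp add: algebra_simps power3_eq_cube power2_eq_square)
qed

lemma cubic_root_unique:
  fixes p q y :: real
  assumes "0 < p" "0 < q" "0 < y" and "p + y * p ^ 3 = 1" "q + y * q ^ 3 = 1"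
  shows "p = q"
proof -
  have less: "a + y * a ^ 3 < b + y * b ^ 3" if "0 < a" "a < b" for a b :: real
    using that \<open>0 < y\<close> by (intro add_strict_mono mult_strict_left_mono power_strict_mono) auto
  then show ?thesis using assms by (metis less_irrefl linorder_neqE_linordered_idom)
qed

theorem theorem1p1:
  fixes F :: "real \<Rightarrow> real"
  assumes "continuous_on {0..} F"
    and "sublinear F"
    and "viscosity_solution (\<lambda>x r p. 1 / 2 * (p - 1) * (p - 2) + r / x - 1) {0<..} F"
    and "\<forall>x\<ge>0. 0 \<le> F x \<and> F x \<le> x"
  shows "(\<forall>x\<ge>0. F x = 0) \<or> (\<exists>c>0. \<forall>x\<ge>0. F x = 1 / c * Fbar (c * x))"
proof (cases "\<exists>a>0. 0 < F a")
  case False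
  then have "F x = 0" if "0 \<le> x" for x
    using assms(4) that by (metis leD less_eq_real_def)
  then show ?thesis by simp
next
  case True
  have F0: "F 0 = 0" using assms(4) by (metis order_antisym order_refl)
  note ode = viscosity_solution_classical[OF assms(1,3,4)]
  have pos: "0 < F x" if "0 < x" for x
    using True slow_solution_pos[OF ode assms(4)] that by blast
  have u: "0 < F x / x" "F x / x \<le> 1" if "0 < x" for x using assms(4) pos that by auto
  obtain c where c: "c \<ge> 0"
    and eq: "\<And>x. 0 < x \<Longrightarrow> slow_slope (F x / x) + c * x * slow_slope (F x / x) ^ 3 = 1"
    using slow_solution_first_integral[OF ode assms(4) pos] by blast
  have "c \<noteq> 0"
  proof
    assume "c = 0"
    then have "F x / x = 1" if "0 < x" for x
      using eq[OF that] slow_slope_root[OF u(2)[OF that]] by simp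
    then have "\<forall>\<^sub>F x in at_top. F x / x = 1"
      using eventually_gt_at_top[of "0::real"] by (rule eventually_mono[rotated])
    then have "((\<lambda>x. F x / x) \<longlongrightarrow> 1) at_top" by (rule tendsto_eventually)
    then show False
      using assms(2) tendsto_unique[OF trivial_limit_at_top_linorder] unfolding sublinear_def by fastforce
  qed
  then have "0 < c" using c by simp
  have "F x = 1 / c * Fbar (c * x)" if "0 \<le> x" for x
  proof (cases "x = 0")
    case True
    then show ?thesis using F0 is_Fbar_Fbar by (simp add: is_Fbar_def)
  next
    case False
    then have "0 < x" using that by simp
    have slopes: "slow_slope (F y / y) = Fbar_slope (c * y)" if y: "0 < y" for y
    proof (rule cubic_root_unique[of _ _ "c * y"])
      have "slow_slope (F y / y) \<noteq> 0" using eq[OF y] by auto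
      then show "0 < slow_slope (F y / y)" using slow_slope_nonneg u(1)[OF y] by (simp add: less_le)
    qed (use eq[OF y] Fbar_slope_root[of "c * y"] y \<open>0 < c\<close> in auto)
    have "((\<lambda>y. F y - 1 / c * Fbar (c * y)) has_real_derivative 0) (at y)" if y: "0 < y" for y
    proof -
      have "(Fbar has_real_derivative Fbar_slope (c * y)) (at (c * y))"
        using is_Fbar_Fbar y \<open>0 < c\<close> by (simp add: is_Fbar_def)
      then have "((\<lambda>y. Fbar (c * y)) has_real_derivative Fbar_slope (c * y) * c) (at y)"
        by (rule DERIV_chain2) (auto intro!: derivative_eq_intros)
      then show ?thesis using ode[OF y] slopes[OF y] \<open>0 < c\<close>
        by (auto intro!: derivative_eq_intros)
    qed
    moreover have "continuous_on {0..x} (\<lambda>y. F y - 1 / c * Fbar (c * y))"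
    proof -
      have "continuous_on {0..x} (\<lambda>y. Fbar (c * y))"
        by (rule continuous_on_compose2[of "{0..}" Fbar])
           (use is_Fbar_Fbar \<open>0 < c\<close> in \<open>auto simp: is_Fbar_def intro!: continuous_intros\<close>)
      then show ?thesis
        by (intro continuous_intros continuous_on_subset[OF assms(1)]) auto
    qed
    ultimately have "F x - 1 / c * Fbar (c * x) = F 0 - 1 / c * Fbar (c * 0)"
      using DERIV_isconst_end[OF \<open>0 < x\<close>, of "\<lambda>y. F y - 1 / c * Fbar (c * y)"] by blast
    then show ?thesis using F0 is_Fbar_Fbar by (simp add: is_Fbar_def)
  qed
  then show ?thesis using \<open>0 < c\<close> by blast
qed

end
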